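(* Let $P$ be a pinwheel tiling. The minimal number of colours in a proper face colouring of $P$ is $3$.
   Context: Pinwheel substitution. The prototile $K$ is the right triangle with side lengths $1,2,\sqrt5$. The substitution $\omega$ expands a tile by $\sqrt5$ and dissects it into five tiles: the expanded tile, placed as the triangle with vertices $(0,0)$ (right angle), $(2,-1)$, $(2,4)$, is dissected into the triangles with vertices $\{(2,-1),(2,0),(0,0)\}$, $\{(0,0),(1,0),(1,2)\}$, $\{(1,0),(2,0),(1,2)\}$, $\{(2,0),(2,2),(1,2)\}$, $\{(1,2),(2,2),(2,4)\}$. The rule is extended to all congruent copies of $K$ (including reflections) and to collections of tiles covariantly. A pinwheel tiling is a tiling $P$ of $\mathbb{R}^2$ by congruent copies of $K$ such that every finite set of tiles of $P$ is contained in a congruent copy of $\omega^n(K)$ for some $n\ge0$. A proper face colouring is an assignment of colours to the tiles such that any two distinct tiles whose boundaries share a segment of positive length have different colours. *)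

theory Defs
  imports "HOL-Analysis.Analysis"
begin

definition isometry :: "(real^2 \<Rightarrow> real^2) \<Rightarrow> bool" where
  "isometry f \<longleftrightarrow> (\<forall>x y. dist (f x) (f y) = dist x y)"

definition triangle :: "real^2 \<Rightarrow> real^2 \<Rightarrow> real^2 \<Rightarrow> (real^2) set" where
  "triangle a b c = convex hull {a, b, c}"

text \<open>The prototile has side lengths 1, 2, sqrt 5; it is positioned so that its expansion by
  the factor sqrt 5 is the triangle with vertices (0,0), (2,-1), (2,4).\<close>

definition prototile :: "(real^2) set" where
  "prototile =
    (\<lambda>x. x /\<^sub>R sqrt 5) ` triangle (vector [0, 0]) (vector [2, -1]) (vector [2, 4])"

definition dissection :: "(real^2) set set" where
  "dissection =
    {triangle (vector [2, -1]) (vector [2, 0]) (vector [0, 0]),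
     triangle (vector [0, 0]) (vector [1, 0]) (vector [1, 2]),
     triangle (vector [1, 0]) (vector [2, 0]) (vector [1, 2]),
     triangle (vector [2, 0]) (vector [2, 2]) (vector [1, 2]),
     triangle (vector [1, 2]) (vector [2, 2]) (vector [2, 4])}"

definition tile :: "(real^2) set \<Rightarrow> bool" where
  "tile T \<longleftrightarrow> (\<exists>f. isometry f \<and> T = f ` prototile)"

text \<open>Covariant extension of the substitution: if a tile is the image of the prototile under an
  isometry f, its expansion is the image of the expanded prototile under the conjugate of f by the
  scaling with factor sqrt 5. The prototile is scalene, so f is determined by the tile and the set
  below consists of exactly five tiles.\<close>

definition subst_tile :: "(real^2) set \<Rightarrow> (real^2) set set" where
  "subst_tile T =
    {(\<lambda>x. sqrt 5 *\<^sub>R f (x /\<^sub>R sqrt 5)) ` D | f D.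
       isometry f \<and> T = f ` prototile \<and> D \<in> dissection}"

definition pinwheel_subst :: "(real^2) set set \<Rightarrow> (real^2) set set" where
  "pinwheel_subst C = (\<Union>T\<in>C. subst_tile T)"

definition supertile :: "nat \<Rightarrow> (real^2) set set" where
  "supertile n = (pinwheel_subst ^^ n) {prototile}"

definition tiling :: "(real^2) set set \<Rightarrow> bool" where
  "tiling P \<longleftrightarrow> (\<forall>T\<in>P. tile T) \<and> \<Union>P = UNIV \<and>
     pairwise (\<lambda>S T. interior S \<inter> interior T = {}) P"

definition pinwheel_tiling :: "(real^2) set set \<Rightarrow> bool" where
  "pinwheel_tiling P \<longleftrightarrow> tiling P \<and>
     (\<forall>F. finite F \<and> F \<subseteq> P \<longrightarrow>
       (\<exists>n g. isometry g \<and> F \<subseteq> (\<lambda>T. g ` T) ` supertile n))"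

definition share_segment :: "(real^2) set \<Rightarrow> (real^2) set \<Rightarrow> bool" where
  "share_segment S T \<longleftrightarrow>
     (\<exists>a b. a \<noteq> b \<and> closed_segment a b \<subseteq> frontier S \<inter> frontier T)"

definition proper_face_colouring :: "(real^2) set set \<Rightarrow> ((real^2) set \<Rightarrow> 'c) \<Rightarrow> bool" where
  "proper_face_colouring P c \<longleftrightarrow>
     (\<forall>S\<in>P. \<forall>T\<in>P. S \<noteq> T \<and> share_segment S T \<longrightarrow> c S \<noteq> c T)"

definition face_colourable :: "(real^2) set set \<Rightarrow> nat \<Rightarrow> bool" where
  "face_colourable P k \<longleftrightarrow>
     (\<exists>c :: (real^2) set \<Rightarrow> nat. proper_face_colouring P c \<and> c ` P \<subseteq> {..<k})"

end

(*
  Cut the long leg of every tile at its midpoint. Then, up to finitely many points, two tiles of a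
  supertile meet only along whole units (short leg, half long leg, hypotenuse), and only nine kinds
  of contact occur: this follows by induction on the level, because under substitution a leg unit
  becomes the hypotenuse of a child, and a hypotenuse becomes five leg units of children.

  Three colours suffice: a finite automaton reads the address of a tile in its supertile, and its
  last state determines the colour. For every kind of contact there is a relation between the states
  of the two tiles which forces different colours and is inherited by the contacts between children.
  So every finite part of the tiling is properly 3-colourable, and by compactness the whole of it is.

  Two colours do not suffice: the first three children of any tile touch each other along segments.
  For the tiling to contain such a triple, apply the defining property to one tile, to a tile that
  differs from it, and to the tiles covering an inner point of each possible sibling of the first.
*)
theory Submission
  imports Defs
begin

section \<open>States, contacts and their inheritance as a finite table\<close>

datatype kid = K1 | K2 | K3 | K4 | K5

text \<open>The long leg of a tile is cut at its midpoint into the half \<open>Near\<close> the right angle and the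
  \<open>Far\<close> half. Units are directed: \<open>Short\<close> and \<open>Hyp\<close> start at the common vertex of short leg and
  hypotenuse, \<open>Near\<close> at the right angle and \<open>Far\<close> at the midpoint.\<close>

datatype edge_unit = Short | Near | Far | Hyp

text \<open>The colour of a tile in state \<open>(x, c)\<close> is \<open>c mod 3\<close>. The table, and with it the invariant
  \<open>admissible\<close>, was found by a computer search.\<close>

fun next_state :: "bool \<times> int \<Rightarrow> kid \<Rightarrow> bool \<times> int" where
  "next_state (x, c) K1 = (x, (if x then 1 else 0) - c)"
| "next_state (x, c) K2 = (\<not> x, (if x then 0 else 2) - c)"
| "next_state (x, c) K3 = (\<not> x, (if x then 2 else 1) - c)"
| "next_state (x, c) K4 = (x, - c)"
| "next_state (x, c) K5 = (x, (if x then 2 else 1) - c)"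

text \<open>Which states may occur on the two sides of an edge whose units are the given ones; the flag
  tells whether these units are traversed in the same direction.\<close>

fun admissible :: "edge_unit \<Rightarrow> edge_unit \<Rightarrow> bool \<Rightarrow> bool \<times> int \<Rightarrow> bool \<times> int \<Rightarrow> bool" where
  "admissible Short Short True (x, c) (y, e) \<longleftrightarrow> x = y \<and> \<not> 3 dvd c - e"
| "admissible Near Near True (x, c) (y, e) \<longleftrightarrow> x = y \<and> \<not> 3 dvd c - e"
| "admissible Far Far True (x, c) (y, e) \<longleftrightarrow> x = y \<and> \<not> 3 dvd c - e"
| "admissible Hyp Hyp True (x, c) (y, e) \<longleftrightarrow> x = y \<and> \<not> 3 dvd c - e"
| "admissible Short Far False (x, c) (y, e) \<longleftrightarrow> x \<noteq> y \<and> 3 dvd c + 1 - e"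
| "admissible Short Near True (x, c) (y, e) \<longleftrightarrow> x \<noteq> y \<and> 3 dvd c - 1 - e"
| "admissible Far Near True (x, c) (y, e) \<longleftrightarrow> x \<noteq> y \<and> 3 dvd c - (if x then 1 else -1) - e"
| "admissible Hyp Hyp False (x, c) (y, e) \<longleftrightarrow> x \<noteq> y \<and> 3 dvd c - (if x then 1 else -1) - e"
| "admissible Near Near False (x, c) (y, e) \<longleftrightarrow> x \<noteq> y \<and> 3 dvd c + (if x then 1 else -1) - e"
| "admissible _ _ _ _ _ \<longleftrightarrow> False"

text \<open>\<open>admissible\<close> lists each kind of contact in one order only; hence the
  symmetrisation.\<close>

definition contact_state ::
    "edge_unit \<Rightarrow> edge_unit \<Rightarrow> bool \<Rightarrow> bool \<times> int \<Rightarrow> bool \<times> int \<Rightarrow> bool" where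
  "contact_state x y d s t \<longleftrightarrow> admissible x y d s t \<or> admissible y x d t s"

lemma contact_state_sym: "contact_state x y d s t \<Longrightarrow> contact_state y x d t s"
  by (auto simp: contact_state_def)

text \<open>Every line of the table either forbids \<open>c - e\<close> to be 0 modulo 3 or fixes it
  to 1 or -1 modulo 3.\<close>

lemma contact_state_colours:
  assumes "contact_state x y d s t"
  shows "snd s mod 3 \<noteq> snd t mod 3"
proof -
  have "contact_state x y d (a, c) (b, e) \<Longrightarrow> c mod 3 \<noteq> e mod 3" for a b c e
    unfolding contact_state_def
    by (induct x; induct y; induct d; induct a; induct b; simp; presburger)
  from this[of "fst s" "snd s" "fst t" "snd t"] show ?thesis
    using assms by simp
qed

lemma contact_state_leg:
  assumes "contact_state x y d s t" "x \<noteq> Hyp \<or> y \<noteq> Hyp"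
  shows "x \<noteq> Hyp" "y \<noteq> Hyp"
  using assms unfolding contact_state_def
  by (cases s; cases t; cases x; cases y; cases d; simp)+

text \<open>The child whose hypotenuse is the expanded unit. \<open>Hyp\<close> has no such child:
  its expansion is spread over three children.\<close>

fun leg_kid :: "edge_unit \<Rightarrow> kid" where
  "leg_kid Short = K1"
| "leg_kid Near = K2"
| "leg_kid Far = K5"
| "leg_kid Hyp = undefined"

text \<open>The flag \<open>d\<close> persists because the hypotenuse of the child is directed like
  the leg unit that it covers; the rest is a finite check modulo 3.\<close>

lemma contact_state_leg_kids:
  assumes "contact_state x y d s t" "x \<noteq> Hyp" "y \<noteq> Hyp"
  shows "contact_state Hyp Hyp d (next_state s (leg_kid x)) (next_state t (leg_kid y))"
proof -
  have "contact_state x y d (a, c) (b, e) \<Longrightarrow> x \<noteq> Hyp \<Longrightarrow> y \<noteq> Hyp \<Longrightarrow>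
      contact_state Hyp Hyp d (next_state (a, c) (leg_kid x)) (next_state (b, e) (leg_kid y))"
    for a b c e
    unfolding contact_state_def
    by (induct x; induct y; induct d; induct a; induct b; simp; presburger)
  from this[of "fst s" "snd s" "fst t" "snd t"] show ?thesis
    using assms by simp
qed

text \<open>The five units of children that make up the hypotenuse of the expanded tile, counted from the
  end at the short leg.\<close>

fun hyp_piece :: "nat \<Rightarrow> kid \<times> edge_unit \<times> bool" where
  "hyp_piece k = (if k = 0 then (K1, Short, True) else if k = 1 then (K4, Far, False)
     else if k = 2 then (K4, Near, False) else if k = 3 then (K5, Near, True)
     else (K5, Far, True))"

lemma nat_less_5_cases:
  assumes "(k::nat) < 5"
  obtains "k = 0" | "k = 1" | "k = 2" | "k = 3" | "k = 4"
  using assms by linarith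

text \<open>The Booleans \<open>a\<close> and \<open>b\<close> record whether a piece is directed
  along the hypotenuse. Oppositely directed hypotenuses pair piece \<open>k\<close> with piece
  \<open>4 - k\<close>, and the two pieces run the same way iff an even number of \<open>d\<close>,
  \<open>a\<close>, \<open>b\<close> is false.\<close>

lemma contact_state_hyp_kids:
  assumes "contact_state Hyp Hyp d s t" "k < 5"
    and "hyp_piece k = (i, x, a)" "hyp_piece (if d then k else 4 - k) = (j, y, b)"
  shows "contact_state x y (d = (a = b)) (next_state s i) (next_state t j)"
proof -
  have "contact_state Hyp Hyp d (p, c) (q, e) \<Longrightarrow>
      case (hyp_piece k, hyp_piece (if d then k else 4 - k)) of ((i, x, a), (j, y, b)) \<Rightarrow>
        contact_state x y (d = (a = b)) (next_state (p, c) i) (next_state (q, e) j)"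
    for p q c e
    unfolding contact_state_def
    by (rule nat_less_5_cases[OF \<open>k < 5\<close>]; hypsubst; induct d; induct p; induct q; simp; presburger)
  from this[of "fst s" "snd s" "fst t" "snd t"] show ?thesis
    using assms by simp
qed

text \<open>The six units along which the children of one tile touch, whatever the state of the
  parent; all contacts in a supertile descend from these.\<close>

lemma contact_state_siblings:
  "contact_state Short Far False (next_state s K2) (next_state s K1)"
  "contact_state Short Near True (next_state s K3) (next_state s K1)"
  "contact_state Near Near True (next_state s K2) (next_state s K3)"
  "contact_state Far Far True (next_state s K2) (next_state s K3)"
  "contact_state Hyp Hyp False (next_state s K3) (next_state s K4)"
  "contact_state Short Short True (next_state s K4) (next_state s K5)"
  unfolding contact_state_def
  by (cases s; cases "fst s"; simp; presburger)+

section \<open>Coordinates, and the contacts between siblings\<close>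

text \<open>A tile is the image of \<open>unit_triangle\<close> under a map that puts the right angle at the origin and
  the legs on the axes; \<open>kid_map i\<close> embeds the \<open>i\<close>-th child into its parent, both in such coordinates.
  Here \<open>kid_chart\<close> uses the frame in which the expanded parent has vertices \<open>(0,0)\<close>, \<open>(2,-1)\<close>, \<open>(2,4)\<close>,
  and the linear map in \<open>kid_map\<close> takes these to \<open>(0,0)\<close>, \<open>(1,0)\<close>, \<open>(0,2)\<close>.\<close>

definition unit_triangle :: "(real \<times> real) set" where
  "unit_triangle = {(x, y). 0 \<le> x \<and> 0 \<le> y \<and> 2 * x + y \<le> 2}"

fun kid_chart :: "kid \<Rightarrow> real \<times> real \<Rightarrow> real \<times> real" where
  "kid_chart K1 (x, y) = (2 - y, - x)"
| "kid_chart K2 (x, y) = (1 - x, y)"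
| "kid_chart K3 (x, y) = (1 + x, y)"
| "kid_chart K4 (x, y) = (2 - x, 2 - y)"
| "kid_chart K5 (x, y) = (2 - x, 2 + y)"

definition kid_map :: "kid \<Rightarrow> real \<times> real \<Rightarrow> real \<times> real" where
  "kid_map i p = (let (X, Y) = kid_chart i p in ((2 * X - Y) / 5, (X + 2 * Y) / 5))"

fun edge_pt :: "edge_unit \<Rightarrow> real \<Rightarrow> real \<times> real" where
  "edge_pt Short t = (1 - t, 0)"
| "edge_pt Near t = (0, t)"
| "edge_pt Far t = (0, 1 + t)"
| "edge_pt Hyp t = (1 - t, 2 * t)"

definition orient :: "bool \<Rightarrow> real \<Rightarrow> real" where
  "orient d t = (if d then t else 1 - t)"

text \<open>The codomain is left open so that the notion applies both to children inside a parent
  and to tiles in the plane.\<close>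

definition glued ::
    "edge_unit \<Rightarrow> edge_unit \<Rightarrow> bool \<Rightarrow> (real \<times> real \<Rightarrow> 'a) \<Rightarrow> (real \<times> real \<Rightarrow> 'a) \<Rightarrow> bool" where
  "glued x y d M M' \<longleftrightarrow> (\<forall>t\<in>{0..1}. M (edge_pt x t) = M' (edge_pt y (orient d t)))"

lemma orient_in: "t \<in> {0..1} \<Longrightarrow> orient d t \<in> {0..1}"
  by (auto simp: orient_def)

lemma orient_orient: "orient d (orient d t) = t"
  by (auto simp: orient_def)

lemma glued_sym: "glued x y d M M' \<Longrightarrow> glued y x d M' M"
  unfolding glued_def
proof
  fix t :: real
  assume *: "\<forall>t\<in>{0..1}. M (edge_pt x t) = M' (edge_pt y (orient d t))" and "t \<in> {0..1}"
  then show "M' (edge_pt y t) = M (edge_pt x (orient d t))"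
    using bspec[OF *, of "orient d t"] by (simp only: orient_in orient_orient)
qed

lemma inj_kid_map: "inj (kid_map i)"
  by (rule injI; cases i; auto simp: kid_map_def split: prod.splits)

lemma kid_map_in: "p \<in> unit_triangle \<Longrightarrow> kid_map i p \<in> unit_triangle"
  by (cases i; cases p; auto simp: kid_map_def unit_triangle_def field_simps)

lemma edge_pt_in: "t \<in> {0..1} \<Longrightarrow> edge_pt x t \<in> unit_triangle"
  by (cases x; auto simp: unit_triangle_def)

text \<open>The exceptional points: siblings that share no unit meet in vertices only.\<close>

definition corners :: "(real \<times> real) set" where
  "corners = {(0, 0), (1, 0), (0, 2)}"

lemma kid_map_eq_iff: "kid_map i p = kid_map j q \<longleftrightarrow> kid_chart i p = kid_chart j q"
  by (cases "kid_chart i p"; cases "kid_chart j q"; auto simp: kid_map_def)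

definition touching :: "(real \<times> real \<Rightarrow> 'a) \<Rightarrow> (real \<times> real \<Rightarrow> 'a) \<Rightarrow> bool \<times> int \<Rightarrow> bool \<times> int \<Rightarrow>
    real \<times> real \<Rightarrow> real \<times> real \<Rightarrow> bool" where
  "touching M M' s s' p q \<longleftrightarrow> (\<exists>x y d t. t \<in> {0..1} \<and> contact_state x y d s s' \<and> glued x y d M M' \<and>
     p = edge_pt x t \<and> q = edge_pt y (orient d t))"

lemma touching_sym: "touching M M' s s' p q \<Longrightarrow> touching M' M s' s q p"
proof -
  assume "touching M M' s s' p q"
  then obtain x y d t where "t \<in> {0..1}" "contact_state x y d s s'" "glued x y d M M'"
    "p = edge_pt x t" "q = edge_pt y (orient d t)"
    unfolding touching_def by blast
  then show ?thesis
    unfolding touching_def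
    by (intro exI[of _ y] exI[of _ x] exI[of _ d] exI[of _ "orient d t"])
      (simp only: contact_state_sym glued_sym orient_in orient_orient)
qed

lemma touchingI:
  assumes "contact_state x y d s s'" "glued x y d M M'" "t \<in> {0..1}"
    "p = edge_pt x t" "q = edge_pt y (orient d t)"
  shows "touching M M' s s' p q"
  using assms unfolding touching_def by blast

lemma glued_siblings:
  "glued Short Far False (kid_map K2) (kid_map K1)"
  "glued Short Near True (kid_map K3) (kid_map K1)"
  "glued Near Near True (kid_map K2) (kid_map K3)"
  "glued Far Far True (kid_map K2) (kid_map K3)"
  "glued Hyp Hyp False (kid_map K3) (kid_map K4)"
  "glued Short Short True (kid_map K4) (kid_map K5)"
  by (auto simp: glued_def orient_def kid_map_eq_iff)

lemma siblings_touching: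
  assumes "p \<in> unit_triangle" "q \<in> unit_triangle" "i \<noteq> j" "kid_map i p = kid_map j q" "p \<notin> corners"
  shows "touching (kid_map i) (kid_map j) (next_state s i) (next_state s j) p q"
proof -
  obtain a b c e where [simp]: "p = (a, b)" "q = (c, e)"
    by fastforce
  have tri: "0 \<le> a" "0 \<le> b" "2 * a + b \<le> 2" "0 \<le> c" "0 \<le> e" "2 * c + e \<le> 2"
    using assms(1,2) by (auto simp: unit_triangle_def)
  have chart: "kid_chart i (a, b) = kid_chart j (c, e)"
    using assms(4) by (simp add: kid_map_eq_iff)
  note cs = contact_state_siblings[of s]
  have 12: "touching (kid_map K2) (kid_map K1) (next_state s K2) (next_state s K1) (x, y) (x', y')"
    if "1 - x = 2 - y'" "y = - x'" "0 \<le> x" "0 \<le> y" "2 * x + y \<le> 2" "0 \<le> x'" "0 \<le> y'" "2 * x' + y' \<le> 2"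
    for x y x' y'
    using that by (intro touchingI[OF cs(1) glued_siblings(1), of "1 - x"]) (auto simp: orient_def)
  have 13: "touching (kid_map K3) (kid_map K1) (next_state s K3) (next_state s K1) (x, y) (x', y')"
    if "1 + x = 2 - y'" "y = - x'" "0 \<le> x" "0 \<le> y" "2 * x + y \<le> 2" "0 \<le> x'" "0 \<le> y'" "2 * x' + y' \<le> 2"
    for x y x' y'
    using that by (intro touchingI[OF cs(2) glued_siblings(2), of "1 - x"]) (auto simp: orient_def)
  have 23: "touching (kid_map K2) (kid_map K3) (next_state s K2) (next_state s K3) (x, y) (x', y')"
    if "1 - x = 1 + x'" "y = y'" "0 \<le> x" "0 \<le> y" "2 * x + y \<le> 2" "0 \<le> x'" "0 \<le> y'" "2 * x' + y' \<le> 2"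
    for x y x' y'
  proof (cases "y \<le> 1")
    case True
    then show ?thesis
      using that by (intro touchingI[OF cs(3) glued_siblings(3), of y]) (auto simp: orient_def)
  next
    case False
    then show ?thesis
      using that by (intro touchingI[OF cs(4) glued_siblings(4), of "y - 1"]) (auto simp: orient_def)
  qed
  have 34: "touching (kid_map K3) (kid_map K4) (next_state s K3) (next_state s K4) (x, y) (x', y')"
    if "1 + x = 2 - x'" "y = 2 - y'" "0 \<le> x" "0 \<le> y" "2 * x + y \<le> 2" "0 \<le> x'" "0 \<le> y'" "2 * x' + y' \<le> 2"
    for x y x' y'
    using that by (intro touchingI[OF cs(5) glued_siblings(5), of "1 - x"]) (auto simp: orient_def)
  have 45: "touching (kid_map K4) (kid_map K5) (next_state s K4) (next_state s K5) (x, y) (x', y')"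
    if "2 - x = 2 - x'" "2 - y = 2 + y'" "0 \<le> x" "0 \<le> y" "2 * x + y \<le> 2" "0 \<le> x'" "0 \<le> y'" "2 * x' + y' \<le> 2"
    for x y x' y'
    using that by (intro touchingI[OF cs(6) glued_siblings(6), of "1 - x"]) (auto simp: orient_def)
  note t = 12 13 23 34 45
  note t' = t[THEN touching_sym]
  show ?thesis
    \<comment> \<open>Adjacent pairs are settled by the five facts or their mirrored versions; for
      all other pairs the equations are inconsistent or force \<open>p\<close> to be a
      corner.\<close>
    by (insert assms(3,5) chart tri, cases i; cases j; simp add: corners_def;
        (elim conjE)?; ((rule t t'; (linarith | simp)) | (rule FalseE; argo)))
qed

section \<open>Passing contacts from parents to children\<close>

definition fifths :: "real set" where
  "fifths = {0, 1/5, 2/5, 3/5, 4/5, 1}"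

lemma kid_map_eq_pair: "kid_map i p = (a, b) \<longleftrightarrow> kid_chart i p = (2 * a + b, 2 * b - a)"
  by (cases "kid_chart i p"; auto simp: kid_map_def)

lemma edge_pt_leg: "x \<noteq> Hyp \<Longrightarrow> kid_map (leg_kid x) (edge_pt Hyp t) = edge_pt x t"
  by (cases x; simp add: kid_map_eq_pair)

lemma edge_pt_hyp:
  assumes "hyp_piece k = (i, x, a)" "k < 5"
  shows "kid_map i (edge_pt x t) = edge_pt Hyp ((real k + orient a t) / 5)"
  by (insert assms(1), rule nat_less_5_cases[OF assms(2)];
      auto simp: kid_map_def orient_def field_simps)

text \<open>Every other child meets the leg unit at most in an end point, and end points have
  parameters in \<open>fifths\<close>.\<close>

lemma kid_on_leg:
  assumes "p \<in> unit_triangle" "x \<noteq> Hyp" "t \<in> {0..1} - fifths" "edge_pt x t = kid_map i p"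
  shows "i = leg_kid x \<and> p = edge_pt Hyp t"
proof
  obtain a b where p: "p = (a, b)" by fastforce
  have "0 \<le> t" "t \<le> 1" "t \<noteq> 0" "t \<noteq> 1" "t \<noteq> 1/5" "t \<noteq> 2/5" "t \<noteq> 3/5" "t \<noteq> 4/5"
    using assms(3) by (simp_all add: fifths_def)
  moreover have "0 \<le> a" "0 \<le> b" "2 * a + b \<le> 2"
    using assms(1) by (simp_all add: p unit_triangle_def)
  ultimately show "i = leg_kid x"
    using assms(2) assms(4)[symmetric] unfolding p
    by (cases x; cases i; simp add: kid_map_eq_pair; linarith)
  then have "kid_map i p = kid_map i (edge_pt Hyp t)"
    using assms(2,4) edge_pt_leg by metis
  then show "p = edge_pt Hyp t"
    using inj_kid_map by (simp add: inj_eq)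
qed

lemma kid_on_hyp:
  assumes "p \<in> unit_triangle" "t \<in> {0..1} - fifths" "edge_pt Hyp t = kid_map i p"
  obtains k x a r where "k < 5" "hyp_piece k = (i, x, a)" "r \<in> {0<..<1}" "p = edge_pt x (orient a r)"
    "t = (real k + r) / 5"
proof -
  \<comment> \<open>Each piece occupies a fifth of the hypotenuse, so the integer part of
    \<open>5 * t\<close> is the number of the piece and the fractional part the position in
    it.\<close>
  define k where "k = nat \<lfloor>5 * t\<rfloor>"
  define r where "r = 5 * t - real k"
  have "0 \<le> t" "t < 1" using assms(2) by (auto simp: fifths_def less_le)
  then have k: "k < 5" "real k \<le> 5 * t" "5 * t < real k + 1"
    unfolding k_def by linarith+
  have "5 * t \<noteq> real k"
    using k(1) assms(2) by (elim nat_less_5_cases) (auto simp: fifths_def field_simps)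
  then have r: "r \<in> {0<..<1}" "t = (real k + r) / 5"
    using k by (auto simp: r_def)
  obtain j x a where h: "hyp_piece k = (j, x, a)"
    using prod_cases3 by blast
  have "kid_map i p = kid_map j (edge_pt x (orient a r))"
    by (simp only: edge_pt_hyp[OF h k(1)] orient_orient assms(3)[symmetric] r(2))
  have "i = j"
  proof -
    obtain a b where p: "p = (a, b)" by fastforce
    have "0 \<le> a" "0 \<le> b" "2 * a + b \<le> 2"
      using assms(1) by (simp_all add: p unit_triangle_def)
    \<comment> \<open>In this frame the expanded hypotenuse runs from (2,-1) to (2,4), with first
      coordinate 2 throughout.\<close>
    moreover have "kid_chart i (a, b) = (2, 5 * t - 1)"
      using assms(3)[symmetric] by (simp add: p kid_map_eq_pair)
    moreover have "5 * t = real k + r" "0 < r" "r < 1"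
      using r by auto
    ultimately show ?thesis
      using h by (rule_tac nat_less_5_cases[OF k(1)]; hypsubst; cases i; simp; linarith)
  qed
  then have "p = edge_pt x (orient a r)"
    using \<open>kid_map i p = _\<close> inj_kid_map[of i] by (auto dest: injD)
  with that k(1) h r \<open>i = j\<close> show ?thesis by blast
qed

text \<open>The points of an edge where the adjoining child may change: \<open>fifths\<close> marks
  the ends of the five pieces of the hypotenuse.\<close>

definition breakpoints :: "(real \<times> real) set" where
  "breakpoints = (\<Union>x. edge_pt x ` fifths)"

lemma finite_breakpoints: "finite breakpoints"
proof -
  have "(UNIV :: edge_unit set) = {Short, Near, Far, Hyp}"
    using edge_unit.exhaust by blast
  then have "finite (UNIV :: edge_unit set)"
    by (metis finite.emptyI finite.insertI)
  then show ?thesis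
    by (simp add: breakpoints_def fifths_def)
qed

lemma orient_notin_fifths: "t \<notin> fifths \<Longrightarrow> orient d t \<notin> fifths"
  by (auto simp: fifths_def orient_def)

lemma hyp_piece_glued:
  assumes "glued Hyp Hyp d M M'" "k < 5" "hyp_piece k = (i, x, a)"
    and "hyp_piece (if d then k else 4 - k) = (j, y, b)"
  shows "glued x y (d = (a = b)) (M \<circ> kid_map i) (M' \<circ> kid_map j)"
  unfolding glued_def
proof
  fix t :: real
  assume t: "t \<in> {0..1}"
  let ?l = "if d then k else 4 - k"
  let ?u = "(real k + orient a t) / 5"
  have u: "?u \<in> {0..1}"
    using orient_in[OF t, of a] \<open>k < 5\<close> by auto
  have "?l < 5"
    using \<open>k < 5\<close> by auto
  \<comment> \<open>Reversal sends position s of piece k to position 1 - s of piece 4 - k.\<close>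
  have "orient d ?u = (real ?l + orient b (orient (d = (a = b)) t)) / 5"
    using \<open>k < 5\<close> by (auto simp: orient_def field_simps of_nat_diff)
  then have "edge_pt Hyp (orient d ?u) = kid_map j (edge_pt y (orient (d = (a = b)) t))"
    by (simp only: edge_pt_hyp[OF assms(4) \<open>?l < 5\<close>])
  moreover have "M (edge_pt Hyp ?u) = M' (edge_pt Hyp (orient d ?u))"
    using assms(1) u by (simp only: glued_def)
  ultimately show "(M \<circ> kid_map i) (edge_pt x t) =
      (M' \<circ> kid_map j) (edge_pt y (orient (d = (a = b)) t))"
    by (simp only: comp_def edge_pt_hyp[OF assms(3,2)])
qed

text \<open>Away from the break points, the position on the edge determines which children adjoin,
  so the inheritance lemmas for leg units and for hypotenuses apply.\<close>

lemma touching_kids: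
  assumes "touching M M' s s' (kid_map i p) (kid_map j q)"
    and "p \<in> unit_triangle" "q \<in> unit_triangle" "kid_map i p \<notin> breakpoints"
  shows "touching (M \<circ> kid_map i) (M' \<circ> kid_map j) (next_state s i) (next_state s' j) p q"
proof -
  obtain x y d t where t: "t \<in> {0..1}" and c: "contact_state x y d s s'" and g: "glued x y d M M'"
    and p: "kid_map i p = edge_pt x t" and q: "kid_map j q = edge_pt y (orient d t)"
    using assms(1) by (auto simp: touching_def)
  have t5: "t \<in> {0..1} - fifths"
    using assms(4) p t by (auto simp: breakpoints_def)
  then have t5': "orient d t \<in> {0..1} - fifths"
    using orient_in orient_notin_fifths by auto
  show ?thesis
  proof (cases "x \<noteq> Hyp \<or> y \<noteq> Hyp")
    case True
    then have leg: "x \<noteq> Hyp" "y \<noteq> Hyp"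
      using contact_state_leg[OF c] by auto
    have i: "i = leg_kid x" "p = edge_pt Hyp t"
      using kid_on_leg[OF assms(2) leg(1) t5 p[symmetric]] by blast+
    have j: "j = leg_kid y" "q = edge_pt Hyp (orient d t)"
      using kid_on_leg[OF assms(3) leg(2) t5' q[symmetric]] by blast+
    show ?thesis
    proof (rule touchingI[OF _ _ t])
      show "contact_state Hyp Hyp d (next_state s i) (next_state s' j)"
        unfolding i j by (rule contact_state_leg_kids[OF c leg])
      show "glued Hyp Hyp d (M \<circ> kid_map i) (M' \<circ> kid_map j)"
        using g unfolding glued_def i j comp_def edge_pt_leg[OF leg(1)] edge_pt_leg[OF leg(2)] .
    qed (fact i(2) j(2))+
  next
    case False
    then have x: "x = Hyp" and y: "y = Hyp" by auto
    obtain k z a r where k: "k < 5" "hyp_piece k = (i, z, a)" and r: "r \<in> {0<..<1}"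
      and p': "p = edge_pt z (orient a r)" and tk: "t = (real k + r) / 5"
      using kid_on_hyp[OF assms(2) t5] p x by metis
    obtain l z' b r' where l: "l < 5" "hyp_piece l = (j, z', b)" and r': "r' \<in> {0<..<1}"
      and q': "q = edge_pt z' (orient b r')" and tl: "orient d t = (real l + r') / 5"
      using kid_on_hyp[OF assms(3) t5'] q y by metis
    have eq: "l = (if d then k else 4 - k) \<and> r' = orient d r"
    proof (cases d)
      case True
      then have "real l + r' = real k + r" using tk tl by (simp add: orient_def)
      moreover from this have "l = k" using r r' by auto
      ultimately show ?thesis using True by (simp add: orient_def)
    next
      case False
      then have e: "real l + r' = 5 - (real k + r)" using tk tl by (simp add: orient_def field_simps)
      \<comment> \<open>As \<open>r + r'\<close> lies strictly between 0 and 2, the integer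
        \<open>l + k\<close> lies strictly between 3 and 5.\<close>
      then have "real (l + k) < 5" "real (l + k) > 3" using r r' by auto
      then have "l + k = 4" by linarith
      moreover from this have "real l + real k = 4" by linarith
      ultimately show ?thesis using False e by (auto simp: orient_def)
    qed
    have l': "hyp_piece (if d then k else 4 - k) = (j, z', b)"
      using l(2) eq by simp
    show ?thesis
    proof (rule touchingI)
      show "contact_state z z' (d = (a = b)) (next_state s i) (next_state s' j)"
        using contact_state_hyp_kids[OF _ k l'] c x y by simp
      show "glued z z' (d = (a = b)) (M \<circ> kid_map i) (M' \<circ> kid_map j)"
        using hyp_piece_glued[OF _ k l'] g x y by simp
      show "orient a r \<in> {0..1}"
        using r by (intro orient_in) auto
      show "p = edge_pt z (orient a r)" by fact
      show "q = edge_pt z' (orient (d = (a = b)) (orient a r))"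
        using q' eq by (auto simp: orient_def)
    qed
  qed
qed

section \<open>Contacts between the tiles of a supertile\<close>

lemma glued_comp: "glued x y d M M' \<Longrightarrow> glued x y d (f \<circ> M) (f \<circ> M')"
  by (simp add: glued_def)

lemma touching_comp: "touching M M' s s' p q \<Longrightarrow> touching (f \<circ> M) (f \<circ> M') s s' p q"
  unfolding touching_def by (blast intro: glued_comp)

text \<open>Addresses list the most recent choice of a child first: \<open>place w\<close> is the tile of the supertile
  of level \<open>length w\<close> reached by choosing children along the reversal of \<open>w\<close>.\<close>

fun place :: "kid list \<Rightarrow> real \<times> real \<Rightarrow> real^2" where
  "place [] = (\<lambda>(a, b). vector [2 * a + b, 2 * b - a] /\<^sub>R sqrt 5)"
| "place (i # w) = (\<lambda>p. sqrt 5 *\<^sub>R p) \<circ> (place w \<circ> kid_map i)"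

fun state_at :: "kid list \<Rightarrow> bool \<times> int" where
  "state_at [] = (True, 0)"
| "state_at (i # w) = next_state (state_at w) i"

lemma inj_place: "inj (place w)"
proof (induction w)
  case Nil
  show ?case
    by (rule injI) (auto simp: vec_eq_iff forall_2)
next
  case (Cons i w)
  have "inj (\<lambda>p :: real^2. sqrt 5 *\<^sub>R p)"
    by (rule injI) simp
  with Cons show ?case
    unfolding place.simps by (intro inj_compose inj_kid_map)
qed

text \<open>Induction over both addresses. Siblings start a contact; children of different parents
  inherit it. The exceptions of the parents and the break points are pulled back along the injective
  \<open>kid_map i\<close>, so they stay finitely many.\<close>

lemma place_touching:
  assumes "length w = length w'" "w \<noteq> w'"
  shows "\<exists>E. finite E \<and> (\<forall>p\<in>unit_triangle. \<forall>q\<in>unit_triangle. place w p = place w' q \<longrightarrow> p \<notin> E \<longrightarrow>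
           touching (place w) (place w') (state_at w) (state_at w') p q)"
  using assms
proof (induction w w' rule: list_induct2)
  case Nil
  then show ?case by simp
next
  case (Cons i w j w')
  show ?case
  proof (cases "w = w'")
    case True
    then have "i \<noteq> j" using Cons.prems by auto
    have "touching (place (i # w)) (place (j # w')) (state_at (i # w)) (state_at (j # w')) p q"
      if "p \<in> unit_triangle" "q \<in> unit_triangle" "place (i # w) p = place (j # w') q" "p \<notin> corners" for p q
    proof -
      have "kid_map i p = kid_map j q"
        using that(3) injD[OF inj_place, of w] True by simp
      then have "touching (kid_map i) (kid_map j) (next_state (state_at w) i) (next_state (state_at w) j) p q"
        by (rule siblings_touching[OF that(1,2) \<open>i \<noteq> j\<close> _ that(4)])
      then show ?thesis
        unfolding place.simps state_at.simps True by (intro touching_comp)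
    qed
    moreover have "finite corners" by (simp add: corners_def)
    ultimately show ?thesis by blast
  next
    case False
    then obtain E where E: "finite E" "\<And>p q. p \<in> unit_triangle \<Longrightarrow> q \<in> unit_triangle \<Longrightarrow>
        place w p = place w' q \<Longrightarrow> p \<notin> E \<Longrightarrow>
        touching (place w) (place w') (state_at w) (state_at w') p q"
      using Cons.IH by blast
    let ?E = "kid_map i -` (E \<union> breakpoints)"
    have "touching (place (i # w)) (place (j # w')) (state_at (i # w)) (state_at (j # w')) p q"
      if "p \<in> unit_triangle" "q \<in> unit_triangle" "place (i # w) p = place (j # w') q" "p \<notin> ?E" for p q
    proof -
      have "touching (place w) (place w') (state_at w) (state_at w') (kid_map i p) (kid_map j q)"
        using that by (intro E(2)) (auto intro: kid_map_in)
      then have "touching (place w \<circ> kid_map i) (place w' \<circ> kid_map j)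
          (next_state (state_at w) i) (next_state (state_at w') j) p q"
        by (rule touching_kids) (use that in auto)
      then show ?thesis
        unfolding place.simps state_at.simps by (intro touching_comp)
    qed
    moreover have "finite ?E"
      by (intro finite_vimageI inj_kid_map) (simp add: E(1) finite_breakpoints)
    ultimately show ?thesis by blast
  qed
qed

section \<open>Rigid placements of the unit triangle in the plane\<close>

definition placement :: "(real \<times> real \<Rightarrow> real^2) \<Rightarrow> bool" where
  "placement M \<longleftrightarrow> (\<exists>c u v. norm u = 1 \<and> norm v = 1 \<and> inner u v = 0 \<and>
     M = (\<lambda>(x, y). c + x *\<^sub>R u + y *\<^sub>R v))"

lemma norm_orthonormal_comb:
  fixes u v :: "'a::real_inner"
  assumes "norm u = 1" "norm v = 1" "inner u v = 0"
  shows "norm (x *\<^sub>R u + y *\<^sub>R v) = sqrt (x\<^sup>2 + y\<^sup>2)"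
proof -
  have "inner u u = 1" "inner v v = 1"
    using assms(1,2) by (simp_all add: dot_square_norm)
  then show ?thesis
    using assms(3)
    by (simp add: norm_eq_sqrt_inner inner_add_left inner_add_right inner_commute power2_eq_square)
qed

lemma placement_dist:
  assumes "placement M"
  shows "dist (M p) (M q) = dist p q"
proof -
  obtain c u v where *: "norm u = 1" "norm v = 1" "inner u v = 0" "M = (\<lambda>(x, y). c + x *\<^sub>R u + y *\<^sub>R v)"
    using assms by (auto simp: placement_def)
  have "M p - M q = (fst p - fst q) *\<^sub>R u + (snd p - snd q) *\<^sub>R v"
    by (simp add: *(4) case_prod_beta algebra_simps)
  then show ?thesis
    using norm_orthonormal_comb[OF *(1-3)] by (simp add: dist_norm norm_prod_def)
qed

lemma placement_inj: "placement M \<Longrightarrow> inj M"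
  by (metis dist_self injI placement_dist zero_less_dist_iff less_irrefl)

text \<open>Each child map is a similarity of ratio 1 / sqrt 5, which the factor sqrt 5 in
  \<open>place\<close> cancels.\<close>

lemma kid_map_affine:
  obtains a b \<alpha> \<beta> \<gamma> \<delta> where "kid_map i = (\<lambda>(x, y). (a + \<alpha> * x + \<gamma> * y, b + \<beta> * x + \<delta> * y))"
    "\<alpha>\<^sup>2 + \<beta>\<^sup>2 = 1 / 5" "\<gamma>\<^sup>2 + \<delta>\<^sup>2 = 1 / 5" "\<alpha> * \<gamma> + \<beta> * \<delta> = 0"
proof -
  show thesis
  proof (cases i)
    case K1
    show ?thesis
      \<comment> \<open>The values stand for a, \<alpha>, \<gamma>, b, \<beta>, \<delta> in this
        order: the coefficients of the first coordinate, then those of the second.\<close>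
      by (rule that[of "4/5" "1/5" "- 2/5" "2/5" "- 2/5" "- 1/5"])
        (auto simp: K1 fun_eq_iff kid_map_eq_pair power2_eq_square field_simps)
  next
    case K2
    show ?thesis
      by (rule that[of "2/5" "- 2/5" "- 1/5" "1/5" "- 1/5" "2/5"])
        (auto simp: K2 fun_eq_iff kid_map_eq_pair power2_eq_square field_simps)
  next
    case K3
    show ?thesis
      by (rule that[of "2/5" "2/5" "- 1/5" "1/5" "1/5" "2/5"])
        (auto simp: K3 fun_eq_iff kid_map_eq_pair power2_eq_square field_simps)
  next
    case K4
    show ?thesis
      by (rule that[of "2/5" "- 2/5" "1/5" "6/5" "- 1/5" "- 2/5"])
        (auto simp: K4 fun_eq_iff kid_map_eq_pair power2_eq_square field_simps)
  next
    case K5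
    show ?thesis
      by (rule that[of "2/5" "- 2/5" "- 1/5" "6/5" "- 1/5" "2/5"])
        (auto simp: K5 fun_eq_iff kid_map_eq_pair power2_eq_square field_simps)
  qed
qed

lemma placement_kid:
  assumes "placement M"
  shows "placement ((\<lambda>p. sqrt 5 *\<^sub>R p) \<circ> (M \<circ> kid_map i))"
proof -
  obtain c u v where *: "norm u = 1" "norm v = 1" "inner u v = 0" "M = (\<lambda>(x, y). c + x *\<^sub>R u + y *\<^sub>R v)"
    using assms by (auto simp: placement_def)
  obtain a b \<alpha> \<beta> \<gamma> \<delta> where k: "kid_map i = (\<lambda>(x, y). (a + \<alpha> * x + \<gamma> * y, b + \<beta> * x + \<delta> * y))"
    and n: "\<alpha>\<^sup>2 + \<beta>\<^sup>2 = 1 / 5" "\<gamma>\<^sup>2 + \<delta>\<^sup>2 = 1 / 5" and o: "\<alpha> * \<gamma> + \<beta> * \<delta> = 0"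
    by (rule kid_map_affine)
  have uv: "inner u u = 1" "inner v v = 1"
    using *(1,2) by (simp_all add: dot_square_norm)
  let ?u = "sqrt 5 *\<^sub>R (\<alpha> *\<^sub>R u + \<beta> *\<^sub>R v)" and ?v = "sqrt 5 *\<^sub>R (\<gamma> *\<^sub>R u + \<delta> *\<^sub>R v)"
  have "norm ?u = sqrt 5 * sqrt (1 / 5)" "norm ?v = sqrt 5 * sqrt (1 / 5)"
    by (simp_all only: norm_scaleR norm_orthonormal_comb[OF *(1-3)] n) simp_all
  then have "norm ?u = 1" "norm ?v = 1"
    by (simp_all flip: real_sqrt_mult)
  moreover have "inner (\<alpha> *\<^sub>R u + \<beta> *\<^sub>R v) (\<gamma> *\<^sub>R u + \<delta> *\<^sub>R v) = \<alpha> * \<gamma> + \<beta> * \<delta>"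
    using *(3) by (simp add: uv inner_add_left inner_add_right inner_commute[of v u])
  then have "inner ?u ?v = 0"
    using o by simp
  moreover have "(\<lambda>p. sqrt 5 *\<^sub>R p) \<circ> (M \<circ> kid_map i) =
      (\<lambda>(x, y). sqrt 5 *\<^sub>R (c + a *\<^sub>R u + b *\<^sub>R v) + x *\<^sub>R ?u + y *\<^sub>R ?v)"
    by (simp add: fun_eq_iff *(4) k algebra_simps)
  ultimately show ?thesis
    unfolding placement_def by blast
qed

lemma placement_place: "placement (place w)"
proof (induction w)
  case Nil
  let ?u = "(1 / sqrt 5) *\<^sub>R vector [2, -1] :: real^2" and ?v = "(1 / sqrt 5) *\<^sub>R vector [1, 2] :: real^2"
  have "norm (vector [2, -1] :: real^2) = sqrt 5" "norm (vector [1, 2] :: real^2) = sqrt 5"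
    by (simp_all add: norm_eq_sqrt_inner inner_vec_def sum_2)
  then have "norm ?u = 1" "norm ?v = 1"
    by simp_all
  moreover have "inner ?u ?v = 0"
    by (simp add: inner_vec_def sum_2)
  moreover have "place [] = (\<lambda>(x, y). 0 + x *\<^sub>R ?u + y *\<^sub>R ?v)"
    by (auto simp: fun_eq_iff vec_eq_iff forall_2 field_simps)
  ultimately show ?case
    unfolding placement_def by blast
next
  case (Cons i w)
  then show ?case
    unfolding place.simps by (rule placement_kid)
qed

lemma isometry_placement:
  assumes "isometry g" "placement M"
  shows "placement (g \<circ> M)"
proof -
  obtain c u v where *: "norm u = 1" "norm v = 1" "inner u v = 0" "M = (\<lambda>(x, y). c + x *\<^sub>R u + y *\<^sub>R v)"
    using assms(2) by (auto simp: placement_def)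
  \<comment> \<open>Without its translation part, \<open>g\<close> is an isometry fixing the origin,
    hence linear.\<close>
  define h where "h = (\<lambda>x. g x - g 0)"
  have "orthogonal_transformation h"
    unfolding orthogonal_transformation_isometry h_def
    using assms(1) by (simp add: isometry_def dist_norm)
  then have h: "linear h" "\<And>x y. inner (h x) (h y) = inner x y"
    by (auto simp: orthogonal_transformation_def)
  have n: "norm (h x) = norm x" for x
    by (simp add: norm_eq_sqrt_inner h(2))
  have "g \<circ> M = (\<lambda>(x, y). (g 0 + h c) + x *\<^sub>R h u + y *\<^sub>R h v)"
  proof
    fix p :: "real \<times> real"
    have "g (M p) = g 0 + h (M p)" by (simp add: h_def)
    also have "\<dots> = g 0 + h c + fst p *\<^sub>R h u + snd p *\<^sub>R h v"
      by (simp add: *(4) case_prod_beta linear_add[OF h(1)] linear_cmul[OF h(1)])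
    finally show "(g \<circ> M) p = (case p of (x, y) \<Rightarrow> (g 0 + h c) + x *\<^sub>R h u + y *\<^sub>R h v)"
      by (simp add: case_prod_beta)
  qed
  moreover have "norm (h u) = 1" "norm (h v) = 1" "inner (h u) (h v) = 0"
    by (simp_all add: n h(2) *)
  ultimately show ?thesis
    unfolding placement_def by blast
qed

text \<open>The length of the hypotenuse is the diameter of the triangle, attained only by its two
  ends; the distances to the third point then rule out swapping them.\<close>

lemma unit_triangle_rigid:
  assumes "p \<in> unit_triangle" "q \<in> unit_triangle" "r \<in> unit_triangle"
    and "dist p q = dist (1 :: real, 0 :: real) (0, 2)"
    and "dist r p = dist (0 :: real, 0 :: real) (1, 0)"
    and "dist r q = dist (0 :: real, 0 :: real) (0, 2)"
  shows "p = (1, 0) \<and> q = (0, 2) \<and> r = (0, 0)"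
proof -
  obtain a b c d e f where p: "p = (a, b)" "q = (c, d)" "r = (e, f)"
    by (metis surj_pair)
  have t: "0 \<le> a" "0 \<le> b" "2 * a + b \<le> 2" "0 \<le> c" "0 \<le> d" "2 * c + d \<le> 2"
    "0 \<le> e" "0 \<le> f" "2 * e + f \<le> 2"
    using assms(1-3) by (auto simp: unit_triangle_def p)
  have D: "(a - c)\<^sup>2 + (b - d)\<^sup>2 = 5" "(e - a)\<^sup>2 + (f - b)\<^sup>2 = 1" "(e - c)\<^sup>2 + (f - d)\<^sup>2 = 4"
    using assms(4-6)[THEN arg_cong[where f = "\<lambda>d. d\<^sup>2"]]
    by (simp_all add: p dist_Pair_Pair dist_real_def)
  have ac: "\<bar>a - c\<bar> \<le> 1" "\<bar>b - d\<bar> \<le> 2"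
    using t by auto
  have sq: "(a - c)\<^sup>2 \<le> 1\<^sup>2" "(b - d)\<^sup>2 \<le> 2\<^sup>2"
    using ac abs_le_square_iff[of "a - c" 1] abs_le_square_iff[of "b - d" 2] by simp_all
  then have "(a - c)\<^sup>2 = 1\<^sup>2" "(b - d)\<^sup>2 = 2\<^sup>2"
    using D(1) by auto
  then have "a - c = 1 \<or> a - c = - 1" "b - d = 2 \<or> b - d = - 2"
    by (simp_all only: power2_eq_iff)
  then consider "a = 1" "b = 0" "c = 0" "d = 2" | "a = 0" "b = 2" "c = 1" "d = 0"
    using t by linarith
  then show ?thesis
  proof cases
    case 1
    then have "e = 2 * f"
      using D(2,3) by (simp add: power2_eq_square algebra_simps)
    then have "5 * f * f = 4 * f"
      using D(3) 1 by (simp add: power2_eq_square algebra_simps)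
    \<comment> \<open>The solution 4 / 5 belongs to the mirror image (8/5, 4/5) of the right angle
      in the hypotenuse, which lies outside the triangle.\<close>
    then have "f = 0 \<or> f = 4 / 5" by auto
    with \<open>e = 2 * f\<close> t show ?thesis
      using 1 p by auto
  next
    case 2
    then have f: "f = (3 + e) / 2"
      using D(2,3) by (simp add: power2_eq_square algebra_simps)
    then have "e \<le> 1 / 5" "f \<le> 8 / 5" "3 / 2 \<le> f"
      using t by auto
    \<comment> \<open>With the ends swapped, the two squares sum to at most 64/25 + 1 < 4.\<close>
    then have "(f - d)\<^sup>2 \<le> (8/5)\<^sup>2" "(e - c)\<^sup>2 \<le> 1\<^sup>2"
      using 2 t by (auto intro!: power_mono simp: power2_commute[of e 1] simp del: power_one)
    then show ?thesis
      using D(3) by (simp add: power2_eq_square)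
  qed
qed

text \<open>A tile thus determines the isometry chosen in \<open>subst_tile\<close>, so that its
  children can be described by \<open>kid_map\<close>.\<close>

lemma placement_unique:
  assumes "placement M" "placement M'" "M ` unit_triangle = M' ` unit_triangle"
  shows "M = M'"
proof -
  have v: "(0, 0) \<in> unit_triangle" "(1, 0) \<in> unit_triangle" "(0, 2) \<in> unit_triangle"
    by (auto simp: unit_triangle_def)
  then have "M (0, 0) \<in> M' ` unit_triangle" "M (1, 0) \<in> M' ` unit_triangle" "M (0, 2) \<in> M' ` unit_triangle"
    using assms(3) by blast+
  then obtain p q r where t: "p \<in> unit_triangle" "q \<in> unit_triangle" "r \<in> unit_triangle"
    and e: "M (1, 0) = M' p" "M (0, 2) = M' q" "M (0, 0) = M' r"
    by (auto elim!: imageE)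
  have d: "dist a b = dist a' b'" if "M a' = M' a" "M b' = M' b" for a b a' b'
    using that placement_dist[OF assms(1), of a' b'] placement_dist[OF assms(2), of a b] by simp
  have "p = (1, 0) \<and> q = (0, 2) \<and> r = (0, 0)"
    by (rule unit_triangle_rigid[OF t d[OF e(1,2)] d[OF e(3,1)] d[OF e(3,2)]])
  then have eq: "M (1, 0) = M' (1, 0)" "M (0, 2) = M' (0, 2)" "M (0, 0) = M' (0, 0)"
    using e by auto
  obtain c u v c' u' v' where M: "M = (\<lambda>(x, y). c + x *\<^sub>R u + y *\<^sub>R v)"
      "M' = (\<lambda>(x, y). c' + x *\<^sub>R u' + y *\<^sub>R v')"
    using assms(1,2) by (auto simp: placement_def)
  have "c = c'" "u = u'" "v = v'"
    using eq by (auto simp: M)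
  then show ?thesis
    by (simp add: M)
qed

section \<open>Supertiles described by addresses\<close>

lemma triangle_eq_image:
  "triangle a (a + u) (a + 2 *\<^sub>R v) = (\<lambda>(x, y). a + x *\<^sub>R u + y *\<^sub>R v) ` unit_triangle"
proof -
  have "triangle a (a + u) (a + 2 *\<^sub>R v) =
      {a + x *\<^sub>R u + y *\<^sub>R 2 *\<^sub>R v | x y. 0 \<le> x \<and> 0 \<le> y \<and> x + y \<le> 1}"
    by (simp add: triangle_def convex_hull_3_alt)
  also have "\<dots> = (\<lambda>(x, y). a + x *\<^sub>R u + y *\<^sub>R v) ` unit_triangle"
  proof (intro equalityI subsetI)
    fix z assume "z \<in> {a + x *\<^sub>R u + y *\<^sub>R 2 *\<^sub>R v | x y. 0 \<le> x \<and> 0 \<le> y \<and> x + y \<le> 1}"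
    then obtain x y where "z = a + x *\<^sub>R u + (2 * y) *\<^sub>R v" "0 \<le> x" "0 \<le> y" "x + y \<le> 1"
      by (auto simp: mult.commute)
    then show "z \<in> (\<lambda>(x, y). a + x *\<^sub>R u + y *\<^sub>R v) ` unit_triangle"
      by (intro image_eqI[of _ _ "(x, 2 * y)"]) (auto simp: unit_triangle_def)
  next
    fix z assume "z \<in> (\<lambda>(x, y). a + x *\<^sub>R u + y *\<^sub>R v) ` unit_triangle"
    then obtain x y where "z = a + x *\<^sub>R u + (y / 2) *\<^sub>R 2 *\<^sub>R v" "0 \<le> x" "0 \<le> y" "2 * x + y \<le> 2"
      by (auto simp: unit_triangle_def)
    then show "z \<in> {a + x *\<^sub>R u + y *\<^sub>R 2 *\<^sub>R v | x y. 0 \<le> x \<and> 0 \<le> y \<and> x + y \<le> 1}"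
      by (intro CollectI exI[of _ x] exI[of _ "y / 2"]) auto
  qed
  finally show ?thesis .
qed



lemma vec2_eqI: "(x :: real^2) $ 1 = y $ 1 \<Longrightarrow> x $ 2 = y $ 2 \<Longrightarrow> x = y"
  by (simp add: vec_eq_iff forall_2)

lemma prototile_eq: "prototile = place [] ` unit_triangle"
proof -
  have "triangle (vector [0, 0]) (vector [2, -1]) (vector [2, 4]) =
      (\<lambda>(x, y). vector [0, 0] + x *\<^sub>R vector [2, -1] + y *\<^sub>R vector [1, 2] :: real^2) ` unit_triangle"
    unfolding triangle_eq_image[symmetric]
    by (rule arg_cong3[where f = triangle]) (auto intro!: vec2_eqI)
  then show ?thesis
    unfolding prototile_def image_image
    by (auto intro!: image_cong vec2_eqI simp: image_image)
qed

lemma dissection_subset: "D \<in> dissection \<Longrightarrow> \<exists>i. D = place [i] ` unit_triangle"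
proof -
  have eq: "triangle a b c = place [i] ` unit_triangle"
    if "\<And>x y. place [i] (x, y) = a + x *\<^sub>R (b - a) + y *\<^sub>R (c - a) /\<^sub>R 2" for a b c i
  proof -
    have "place [i] = (\<lambda>(x, y). a + x *\<^sub>R (b - a) + y *\<^sub>R ((c - a) /\<^sub>R 2))"
      using that by (auto simp: fun_eq_iff)
    then show ?thesis
      using triangle_eq_image[of a "b - a" "(c - a) /\<^sub>R 2"] by simp
  qed
  \<comment> \<open>The vertices are reordered to be the images of (0, 0), (1, 0) and (0, 2), in
    this order.\<close>
  have "triangle (vector [2, 0]) (vector [2, -1]) (vector [0, 0]) = place [K1] ` unit_triangle"
    "triangle (vector [1, 0]) (vector [0, 0]) (vector [1, 2]) = place [K2] ` unit_triangle"
    "triangle (vector [1, 0]) (vector [2, 0]) (vector [1, 2]) = place [K3] ` unit_triangle"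
    "triangle (vector [2, 2]) (vector [1, 2]) (vector [2, 0]) = place [K4] ` unit_triangle"
    "triangle (vector [2, 2]) (vector [1, 2]) (vector [2, 4]) = place [K5] ` unit_triangle"
    by (rule eq; auto intro!: vec2_eqI simp: kid_map_def field_simps)+
  moreover assume "D \<in> dissection"
  ultimately show ?thesis
    unfolding dissection_def triangle_def by (auto simp: insert_commute)
qed

lemma subst_tile_subset:
  assumes "placement M" "S \<in> subst_tile (M ` unit_triangle)"
  shows "\<exists>i. S = ((\<lambda>p. sqrt 5 *\<^sub>R p) \<circ> (M \<circ> kid_map i)) ` unit_triangle"
proof -
  obtain f D where f: "isometry f" "M ` unit_triangle = f ` prototile" "D \<in> dissection"
    and S: "S = (\<lambda>x. sqrt 5 *\<^sub>R f (x /\<^sub>R sqrt 5)) ` D"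
    using assms(2) by (auto simp: subst_tile_def)
  \<comment> \<open>Uniqueness expresses \<open>f\<close> through \<open>M\<close>; the division by
    sqrt 5 in \<open>subst_tile\<close> then cancels the scaling in
    \<open>place [i]\<close>.\<close>
  have "M = f \<circ> place []"
    using f(2) assms(1) isometry_placement[OF f(1) placement_place]
    by (intro placement_unique) (simp_all only: prototile_eq image_comp)
  moreover obtain i where "D = place [i] ` unit_triangle"
    using dissection_subset[OF f(3)] by blast
  ultimately show ?thesis
    unfolding S by (intro exI[of _ i]) (simp add: image_comp comp_def)
qed

lemma supertile_subset: "T \<in> supertile n \<Longrightarrow> \<exists>w. length w = n \<and> T = place w ` unit_triangle"
proof (induction n arbitrary: T)
  case 0
  then show ?case
    by (simp add: supertile_def prototile_eq)
next
  case (Suc n)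
  then obtain S where "S \<in> supertile n" "T \<in> subst_tile S"
    by (auto simp: supertile_def pinwheel_subst_def)
  moreover obtain w where "length w = n" "S = place w ` unit_triangle"
    using Suc.IH \<open>S \<in> supertile n\<close> by blast
  ultimately obtain i where "T = ((\<lambda>p. sqrt 5 *\<^sub>R p) \<circ> (place w \<circ> kid_map i)) ` unit_triangle"
    using subst_tile_subset[OF placement_place] by blast
  then show ?case
    using \<open>length w = n\<close> by (intro exI[of _ "i # w"]) simp
qed

section \<open>From finite parts to the whole tiling: three colours suffice\<close>

lemma colouring_compactness:
  fixes R :: "'a \<Rightarrow> 'a \<Rightarrow> bool" and k :: nat
  assumes "\<And>F. finite F \<Longrightarrow> F \<subseteq> P \<Longrightarrow>
    \<exists>c. c ` F \<subseteq> {..<k} \<and> (\<forall>x\<in>F. \<forall>y\<in>F. R x y \<longrightarrow> c x \<noteq> c y)"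
  shows "\<exists>c. c ` P \<subseteq> {..<k} \<and> (\<forall>x\<in>P. \<forall>y\<in>P. R x y \<longrightarrow> c x \<noteq> c y)"
proof (cases "k = 0")
  case True
  then have "x \<notin> P" for x
    using assms[of "{x}"] by auto
  then show ?thesis by auto
next
  case False
  \<comment> \<open>The argument of De Bruijn and Erdos via Tychonoff: colourings form a compact
    product space, each constraint is closed because it depends on two coordinates only, and
    finitely many constraints involve finitely many points.\<close>
  let ?X = "product_topology (\<lambda>_. discrete_topology {..<k}) P"
  have top: "topspace ?X = P \<rightarrow>\<^sub>E {..<k}"
    by simp
  define C where "C = (\<lambda>(x, y). {c \<in> topspace ?X. c x \<noteq> c y})"
  define D where "D = {(x, y). x \<in> P \<and> y \<in> P \<and> R x y}"
  have closed: "closedin ?X (C p)" if p: "p \<in> D" for p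
  proof -
    obtain x y where xy: "p = (x, y)" "x \<in> P" "y \<in> P"
      using p by (auto simp: D_def)
    have "continuous_map ?X (discrete_topology ({..<k} \<times> {..<k})) (\<lambda>c. (c x, c y))"
      unfolding prod_topology_discrete_topology continuous_map_paired
      using continuous_map_product_projection[of _ P "\<lambda>_. discrete_topology {..<k}"] xy by simp
    then have "closedin ?X {c \<in> topspace ?X. (c x, c y) \<in> {q \<in> {..<k} \<times> {..<k}. fst q \<noteq> snd q}}"
      by (rule closedin_continuous_map_preimage) auto
    also have "{c \<in> topspace ?X. (c x, c y) \<in> {q \<in> {..<k} \<times> {..<k}. fst q \<noteq> snd q}} = C p"
      using xy by (auto simp: C_def dest: PiE_mem)
    finally show ?thesis .
  qed
  \<comment> \<open>The whole space is added so that the intersection consists of points of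
    \<open>?X\<close> even when \<open>D\<close> is empty.\<close>
  let ?U = "insert (topspace ?X) (C ` D)"
  have "compact_space ?X"
    by (simp add: compact_space_product_topology compact_space_discrete_topology)
  then have fip: "(\<forall>A\<in>?U. closedin ?X A) \<and> (\<forall>\<F>. finite \<F> \<and> \<F> \<subseteq> ?U \<longrightarrow> \<Inter>\<F> \<noteq> {}) \<longrightarrow> \<Inter>?U \<noteq> {}"
    unfolding compact_space_fip by (rule spec)
  have "\<Inter>\<F> \<noteq> {}" if \<F>: "finite \<F> \<and> \<F> \<subseteq> ?U" for \<F>
  proof -
    have "finite (\<F> - {topspace ?X})" "\<F> - {topspace ?X} \<subseteq> C ` D"
      using \<F> by auto
    then obtain G where G: "finite G" "G \<subseteq> D" "\<F> - {topspace ?X} = C ` G"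
      using finite_subset_image by metis
    let ?F = "fst ` G \<union> snd ` G"
    have "finite ?F" "?F \<subseteq> P"
      using G by (auto simp: D_def)
    then obtain c where c: "c ` ?F \<subseteq> {..<k}" "\<And>x y. x \<in> ?F \<Longrightarrow> y \<in> ?F \<Longrightarrow> R x y \<Longrightarrow> c x \<noteq> c y"
      using assms by meson
    \<comment> \<open>Points outside \<open>?F\<close> get colour 0, which is available because
      \<open>k\<close> is positive.\<close>
    define e where "e = restrict (\<lambda>x. if x \<in> ?F then c x else 0) P"
    have e: "e \<in> topspace ?X"
      unfolding top e_def using c(1) False by (intro restrict_PiE_iff[THEN iffD2]) auto
    have "e \<in> C p" if "p \<in> G" for p
    proof -
      obtain x y where p: "p = (x, y)" by fastforce
      then have "x \<in> ?F" "y \<in> ?F" "x \<in> P" "y \<in> P" "R x y"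
        using that G(2) by (auto simp: D_def intro: rev_image_eqI)
      then have "e x \<noteq> e y"
        using c(2)[of x y] by (simp only: e_def restrict_apply' if_True) simp
      then show ?thesis
        using e by (simp add: C_def p)
    qed
    then have "e \<in> A" if "A \<in> \<F>" for A
      using that e G(3) by (cases "A = topspace ?X") blast+
    then show ?thesis by blast
  qed
  moreover have "\<forall>A\<in>?U. closedin ?X A"
    using closed closedin_topspace[of ?X] by blast
  ultimately have "\<Inter>?U \<noteq> {}"
    by (intro mp[OF fip] conjI allI impI)
  then obtain c where "c \<in> \<Inter>?U" by blast
  then have "c \<in> topspace ?X" "\<And>p. p \<in> D \<Longrightarrow> c \<in> C p"
    by blast+
  then show ?thesis
    unfolding top by (intro exI[of _ c]) (auto simp: C_def D_def dest: PiE_mem)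
qed

lemma compact_unit_triangle: "compact unit_triangle"
proof -
  have "unit_triangle = ({0..1} \<times> {0..2}) \<inter> {p. 2 * fst p + snd p \<le> 2}"
    by (auto simp: unit_triangle_def)
  moreover have "closed {p :: real \<times> real. 2 * fst p + snd p \<le> 2}"
    by (intro closed_Collect_le continuous_intros)
  ultimately show ?thesis
    using compact_Int_closed[OF compact_Times[OF compact_Icc compact_Icc]] by metis
qed

lemma closed_placement_image:
  assumes "placement M"
  shows "closed (M ` unit_triangle)"
proof -
  have "continuous_on unit_triangle M"
    unfolding continuous_on_iff placement_dist[OF assms] by blast
  then show ?thesis
    using compact_continuous_image compact_unit_triangle compact_imp_closed by blast
qed

lemma isometry_inj: "isometry g \<Longrightarrow> inj g"
  unfolding isometry_def by (rule injI) (metis dist_eq_0_iff)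

text \<open>A segment has infinitely many points, so one of them avoids the finite exceptional set
  of \<open>place_touching\<close>.\<close>

lemma share_segment_state:
  assumes "length w = length w'" "w \<noteq> w'" "isometry g"
    and "share_segment ((g \<circ> place w) ` unit_triangle) ((g \<circ> place w') ` unit_triangle)"
  shows "snd (state_at w) mod 3 \<noteq> snd (state_at w') mod 3"
proof -
  let ?M = "g \<circ> place w" and ?M' = "g \<circ> place w'"
  have pl: "placement ?M" "placement ?M'"
    using isometry_placement[OF assms(3) placement_place] by auto
  obtain a b where "a \<noteq> b"
    and fr: "closed_segment a b \<subseteq> frontier (?M ` unit_triangle) \<inter> frontier (?M' ` unit_triangle)"
    using assms(4) unfolding share_segment_def by blast
  have ab: "a \<noteq> b" "closed_segment a b \<subseteq> ?M ` unit_triangle" "closed_segment a b \<subseteq> ?M' ` unit_triangle"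
    using \<open>a \<noteq> b\<close> fr frontier_subset_closed[OF closed_placement_image[OF pl(1)]]
      frontier_subset_closed[OF closed_placement_image[OF pl(2)]] by blast+
  obtain E where E: "finite E" "\<And>p q. p \<in> unit_triangle \<Longrightarrow> q \<in> unit_triangle \<Longrightarrow> place w p = place w' q \<Longrightarrow> p \<notin> E \<Longrightarrow>
           touching (place w) (place w') (state_at w) (state_at w') p q"
    using place_touching[OF assms(1,2)] by blast
  have "infinite (closed_segment a b)"
    using ab(1) by simp
  then have "\<not> closed_segment a b \<subseteq> ?M ` E"
    using E(1) finite_subset by blast
  then obtain z where z: "z \<in> closed_segment a b" "z \<notin> ?M ` E" by blast
  have "z \<in> ?M ` unit_triangle" "z \<in> ?M' ` unit_triangle"
    using z(1) ab(2,3) by blast+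
  then obtain p q where pq: "p \<in> unit_triangle" "z = ?M p" "q \<in> unit_triangle" "z = ?M' q"
    by (elim imageE)
  then have "g (place w p) = g (place w' q)"
    by simp
  then have "place w p = place w' q"
    by (rule injD[OF isometry_inj[OF assms(3)]])
  moreover have "p \<notin> E"
    using z(2) pq(2) by blast
  ultimately have "touching (place w) (place w') (state_at w) (state_at w') p q"
    using E(2) pq(1,3) by blast
  then show ?thesis
    unfolding touching_def using contact_state_colours by blast
qed

lemma pinwheel_finite_colouring:
  assumes "pinwheel_tiling P" "finite F" "F \<subseteq> P"
  shows "\<exists>c :: (real^2) set \<Rightarrow> nat. c ` F \<subseteq> {..<3} \<and>
    (\<forall>S\<in>F. \<forall>T\<in>F. S \<noteq> T \<and> share_segment S T \<longrightarrow> c S \<noteq> c T)"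
proof -
  obtain n g where g: "isometry g" "F \<subseteq> (\<lambda>T. g ` T) ` supertile n"
    using assms unfolding pinwheel_tiling_def by blast
  have "\<exists>w. length w = n \<and> S = (g \<circ> place w) ` unit_triangle" if S: "S \<in> F" for S
  proof -
    obtain T where "T \<in> supertile n" "S = g ` T"
      using g(2) S by blast
    then show ?thesis
      using supertile_subset[of T n] by (auto simp: image_comp)
  qed
  then obtain W where W: "\<And>S. S \<in> F \<Longrightarrow> length (W S) = n \<and> S = (g \<circ> place (W S)) ` unit_triangle"
    by metis
  \<comment> \<open>Distinct tiles have distinct addresses of the same length, so
    \<open>share_segment_state\<close> applies to them.\<close>
  define c where "c S = nat (snd (state_at (W S)) mod 3)" for S
  have "c S \<noteq> c T" if "S \<in> F" "T \<in> F" "S \<noteq> T" "share_segment S T" for S T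
  proof -
    have "W S \<noteq> W T"
      using W[OF that(1)] W[OF that(2)] that(3) by metis
    then have "snd (state_at (W S)) mod 3 \<noteq> snd (state_at (W T)) mod 3"
      using W[OF that(1)] W[OF that(2)] that(4) g(1) by (intro share_segment_state[of _ _ g]) auto
    then show ?thesis
      by (simp add: c_def)
  qed
  moreover have "c ` F \<subseteq> {..<3}"
    by (auto simp: c_def nat_less_iff)
  ultimately show ?thesis
    by blast
qed

lemma pinwheel_3_colourable: "pinwheel_tiling P \<Longrightarrow> face_colourable P 3"
  unfolding face_colourable_def proper_face_colouring_def
  using colouring_compactness[of P 3 "\<lambda>S T. S \<noteq> T \<and> share_segment S T"]
    pinwheel_finite_colouring[of P] by auto

section \<open>Two colours do not suffice\<close>

lemma surj_kid_map: "surj (kid_map i)"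
proof -
  have "\<exists>p. kid_map i p = (a, b)" for a b
  proof (cases i)
    case K1
    then have "kid_map i (a - 2 * b, 2 - 2 * a - b) = (a, b)" by (simp add: kid_map_eq_pair)
    then show ?thesis by blast
  next
    case K2
    then have "kid_map i (1 - 2 * a - b, 2 * b - a) = (a, b)" by (simp add: kid_map_eq_pair)
    then show ?thesis by blast
  next
    case K3
    then have "kid_map i (2 * a + b - 1, 2 * b - a) = (a, b)" by (simp add: kid_map_eq_pair)
    then show ?thesis by blast
  next
    case K4
    then have "kid_map i (2 - 2 * a - b, 2 + a - 2 * b) = (a, b)" by (simp add: kid_map_eq_pair)
    then show ?thesis by blast
  next
    case K5
    then have "kid_map i (2 - 2 * a - b, 2 * b - a - 2) = (a, b)" by (simp add: kid_map_eq_pair)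
    then show ?thesis by blast
  qed
  then show ?thesis
    unfolding surj_def by (metis surj_pair)
qed

lemma surj_place: "surj (place w)"
proof (induction w)
  case Nil
  have "\<exists>p. z = place [] p" for z :: "real^2"
    by (intro exI[of _ "(sqrt 5 * (2 * z $ 1 - z $ 2) / 5, sqrt 5 * (z $ 1 + 2 * z $ 2) / 5)"] vec2_eqI)
      (simp_all add: field_simps)
  then show ?case
    unfolding surj_def by blast
next
  case (Cons i w)
  have "surj (\<lambda>p :: real^2. sqrt 5 *\<^sub>R p)"
    by (rule surjI[of _ "\<lambda>p. p /\<^sub>R sqrt 5"]) simp
  with Cons show ?case
    unfolding place.simps by (intro comp_surj surj_kid_map)
qed

text \<open>Chosen so that the open disc of radius 1/4 about it avoids all edges.\<close>

definition inner_pt :: "real \<times> real" where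
  "inner_pt = (1 / 4, 1 / 2)"

lemma inner_pt_nbhd:
  assumes "dist p inner_pt < 1 / 4"
  shows "p \<in> unit_triangle" "p \<noteq> edge_pt x t"
proof -
  obtain a b where p: "p = (a, b)" by fastforce
  have "dist a (1 / 4) < 1 / 4" "dist b (1 / 2) < 1 / 4"
    using dist_fst_le[of p inner_pt] dist_snd_le[of p inner_pt] assms by (auto simp: p inner_pt_def)
  then have *: "0 < a" "0 < b" "2 * a + b < 2"
    by (auto simp: dist_real_def abs_if split: if_splits)
  then show "p \<in> unit_triangle"
    by (simp add: p unit_triangle_def)
  show "p \<noteq> edge_pt x t"
    using * by (cases x) (auto simp: p)
qed

lemma unit_triangle_segment:
  assumes "p \<in> unit_triangle" "q \<in> unit_triangle" "0 \<le> t" "t \<le> 1"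
  shows "p + t *\<^sub>R (q - p) \<in> unit_triangle"
proof -
  obtain a b c e where [simp]: "p = (a, b)" "q = (c, e)"
    by fastforce
  have *: "0 \<le> a" "0 \<le> b" "2 * a + b \<le> 2" "0 \<le> c" "0 \<le> e" "2 * c + e \<le> 2"
    using assms by (auto simp: unit_triangle_def)
  have conv: "x + t * (y - x) = (1 - t) * x + t * y" for x y
    by (simp add: algebra_simps)
  have "(1 - t) * (2 * a + b) + t * (2 * c + e) \<le> (1 - t) * 2 + t * 2"
    using * assms(3,4) by (intro add_mono mult_left_mono) auto
  moreover have "0 \<le> (1 - t) * a + t * c" "0 \<le> (1 - t) * b + t * e"
    using * assms(3,4) by auto
  ultimately show ?thesis
    by (simp add: unit_triangle_def conv algebra_simps)
qed

text \<open>Were the inner point in the other tile, infinitely many points of that tile would be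
  interior points of the first one, whereas common points of the two tiles lie on edges up to
  finitely many exceptions.\<close>

lemma place_inner_pt_notin:
  assumes "length w = length w'" "w \<noteq> w'"
  shows "place w inner_pt \<notin> place w' ` unit_triangle"
proof
  assume "place w inner_pt \<in> place w' ` unit_triangle"
  then obtain r where r: "r \<in> unit_triangle" "place w inner_pt = place w' r"
    by (elim imageE)
  obtain q where q: "q \<in> unit_triangle" "q \<noteq> r"
  proof (cases "r = (0, 0)")
    case True
    then show ?thesis
      by (intro that[of "(1, 0)"]) (auto simp: unit_triangle_def)
  next
    case False
    then show ?thesis
      by (intro that[of "(0, 0)"]) (auto simp: unit_triangle_def)
  qed
  obtain E where E: "finite E" "\<And>p q. p \<in> unit_triangle \<Longrightarrow> q \<in> unit_triangle \<Longrightarrow> place w' p = place w q \<Longrightarrow> p \<notin> E \<Longrightarrow>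
           touching (place w') (place w) (state_at w') (state_at w) p q"
    using place_touching[OF assms(1)[symmetric]] assms(2) by blast
  let ?r = "\<lambda>t. r + t *\<^sub>R (q - r)"
  \<comment> \<open>Up to this parameter the points from \<open>r\<close> towards \<open>q\<close>
    stay in the triangle and within 1/4 of \<open>r\<close>; being preserved by placements, the
    distance bound carries over to \<open>inner_pt\<close>.\<close>
  define \<delta> where "\<delta> = min 1 (1 / (4 * norm (q - r)))"
  have n: "norm (q - r) > 0"
    using q(2) by simp
  then have \<delta>: "0 < \<delta>" "\<delta> \<le> 1" "\<delta> * norm (q - r) \<le> 1 / 4"
    by (auto simp: \<delta>_def min_def field_simps)
  have "inj ?r"
    using q(2) by (auto intro: injI)
  then have "infinite (?r ` {0<..<\<delta>})"
    using \<delta>(1) finite_imageD inj_on_subset infinite_Ioo by (metis subset_UNIV)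
  then obtain t where t: "0 < t" "t < \<delta>" "?r t \<notin> E"
    using E(1) finite_subset[of "?r ` {0<..<\<delta>}" E] by (auto simp: greaterThanLessThan_def)
  obtain p where p: "place w p = place w' (?r t)"
    using surj_place by (metis surj_def)
  have "dist p inner_pt = dist (?r t) r"
    using placement_dist[OF placement_place, of w p inner_pt] placement_dist[OF placement_place, of w' "?r t" r]
      p r(2) by simp
  also have "\<dots> = t * norm (q - r)"
    using t(1) by (simp add: dist_norm)
  also have "\<dots> < \<delta> * norm (q - r)"
    using t(2) n by simp
  finally have "dist p inner_pt < 1 / 4"
    using \<delta>(3) by simp
  note in_pt = inner_pt_nbhd[OF this]
  have "?r t \<in> unit_triangle"
    using t \<delta> by (intro unit_triangle_segment r q) auto
  then have "touching (place w') (place w) (state_at w') (state_at w) (?r t) p"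
    using E(2) in_pt(1) p t(3) by metis
  then show False
    using in_pt(2) by (auto simp: touching_def)
qed

lemma edge_pt_frontier:
  assumes "placement M" "t \<in> {0..1}"
  shows "M (edge_pt x t) \<in> frontier (M ` unit_triangle)"
proof -
  have "M (edge_pt x t) \<notin> interior (M ` unit_triangle)"
  proof
    assume "M (edge_pt x t) \<in> interior (M ` unit_triangle)"
    then obtain e where e: "0 < e" "ball (M (edge_pt x t)) e \<subseteq> M ` unit_triangle"
      by (auto simp: mem_interior)
    obtain p where p: "dist (edge_pt x t) p < e" "p \<notin> unit_triangle"
    proof (cases x)
      case Short
      with e(1) show ?thesis
        by (intro that[of "(1 - t, - e / 2)"]) (auto simp: unit_triangle_def dist_Pair_Pair dist_real_def)
    next
      case Near
      with e(1) show ?thesis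
        by (intro that[of "(- e / 2, t)"]) (auto simp: unit_triangle_def dist_Pair_Pair dist_real_def)
    next
      case Far
      with e(1) show ?thesis
        by (intro that[of "(- e / 2, 1 + t)"]) (auto simp: unit_triangle_def dist_Pair_Pair dist_real_def)
    next
      case Hyp
      with e(1) show ?thesis
        by (intro that[of "(1 - t + e / 2, 2 * t)"]) (auto simp: unit_triangle_def dist_Pair_Pair dist_real_def)
    qed
    have "M p \<in> ball (M (edge_pt x t)) e"
      using p(1) placement_dist[OF assms(1)] by simp
    then have "M p \<in> M ` unit_triangle"
      using e(2) by blast
    then show False
      using p(2) placement_inj[OF assms(1)] by (simp add: inj_image_mem_iff)
  qed
  moreover have "M (edge_pt x t) \<in> M ` unit_triangle"
    using edge_pt_in[OF assms(2)] by blast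
  ultimately show ?thesis
    by (simp add: frontier_def closure_subset[THEN subsetD])
qed

lemma placement_edge_segment:
  assumes "placement M" "z \<in> closed_segment (M (edge_pt x 0)) (M (edge_pt x 1))"
  shows "\<exists>t\<in>{0..1}. z = M (edge_pt x t)"
proof -
  obtain c u v where M: "M = (\<lambda>(x, y). c + x *\<^sub>R u + y *\<^sub>R v)"
    using assms(1) by (auto simp: placement_def)
  obtain t where t: "0 \<le> t" "t \<le> 1" "z = (1 - t) *\<^sub>R M (edge_pt x 0) + t *\<^sub>R M (edge_pt x 1)"
    using assms(2) by (auto simp: closed_segment_def)
  then have "z = M (edge_pt x t)"
    by (cases x) (simp_all add: M vec_eq_iff algebra_simps)
  with t(1,2) show ?thesis by (intro bexI[of _ t]) auto
qed

lemma glued_share_segment: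
  assumes "placement M" "placement M'" "glued x y d M M'"
  shows "share_segment (M ` unit_triangle) (M' ` unit_triangle)"
proof -
  have "z \<in> frontier (M ` unit_triangle) \<inter> frontier (M' ` unit_triangle)"
    if z: "z \<in> closed_segment (M (edge_pt x 0)) (M (edge_pt x 1))" for z
  proof -
    obtain t where t: "t \<in> {0..1}" "z = M (edge_pt x t)"
      using placement_edge_segment[OF assms(1) z] by blast
    then have "z = M' (edge_pt y (orient d t))"
      using assms(3) by (auto simp: glued_def)
    then have "z \<in> frontier (M' ` unit_triangle)"
      using edge_pt_frontier[OF assms(2) orient_in[OF t(1)]] by simp
    moreover have "z \<in> frontier (M ` unit_triangle)"
      using edge_pt_frontier[OF assms(1) t(1)] t(2) by simp
    ultimately show ?thesis by blast
  qed
  moreover have "M (edge_pt x 0) \<noteq> M (edge_pt x 1)"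
    unfolding inj_eq[OF placement_inj[OF assms(1)]] by (cases x) simp_all
  ultimately show ?thesis
    unfolding share_segment_def by blast
qed

lemma finite_kid: "finite (UNIV :: kid set)"
proof -
  have "(UNIV :: kid set) = {K1, K2, K3, K4, K5}"
    using kid.exhaust by blast
  then show ?thesis
    by (metis finite.emptyI finite.insertI)
qed

text \<open>The supertile is only known to contain the chosen finite set; its other tiles need not
  lie in \<open>P\<close>. Siblings are therefore caught through the tiles of \<open>P\<close> that
  cover their inner points.\<close>

lemma pinwheel_siblings:
  assumes "pinwheel_tiling P"
  obtains g w where "isometry g" "\<And>j. (g \<circ> place (j # w)) ` unit_triangle \<in> P"
proof -
  have P: "tiling P" "\<And>F. finite F \<Longrightarrow> F \<subseteq> P \<Longrightarrow>
      \<exists>n g. isometry g \<and> F \<subseteq> (\<lambda>T. g ` T) ` supertile n"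
    using assms by (auto simp: pinwheel_tiling_def)
  have "\<Union>P = UNIV"
    using P(1) by (simp add: tiling_def)
  then have "\<exists>T. T \<in> P \<and> z \<in> T" for z
    by blast
  then obtain tile_at where at: "\<And>z. tile_at z \<in> P" "\<And>z. z \<in> tile_at z"
    by metis
  let ?T = "tile_at 0"
  have "tile ?T"
    using P(1) at(1) by (simp add: tiling_def)
  then obtain f where f: "isometry f" "?T = f ` prototile"
    unfolding tile_def by blast
  define \<phi> where "\<phi> = f \<circ> place []"
  have \<phi>: "placement \<phi>" "?T = \<phi> ` unit_triangle"
    unfolding \<phi>_def using isometry_placement[OF f(1) placement_place] f(2)
    by (simp_all only: prototile_eq image_comp)
  have "compact ?T"
    unfolding \<phi>(2) by (intro compact_continuous_image compact_unit_triangle)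
      (auto simp: continuous_on_iff placement_dist[OF \<phi>(1)])
  then have "?T \<noteq> UNIV"
    using compact_imp_bounded not_bounded_UNIV by metis
  \<comment> \<open>A second tile forces the level to be at least 1, so that \<open>?T\<close> has a
    parent.\<close>
  then obtain z where z: "z \<notin> ?T" by blast
  \<comment> \<open>Which child \<open>?T\<close> is depends on the supertile, obtained only after
    \<open>F\<close> is fixed; so \<open>i\<close> runs through all possibilities and
    \<open>j\<close> through the siblings.\<close>
  define s where "s = (\<lambda>(i, j). \<phi> (inv (kid_map i) (kid_map j inner_pt)))"
  define F where "F = {?T, tile_at z} \<union> range (tile_at \<circ> s)"
  have "finite F"
    unfolding F_def using finite_kid by (simp add: finite_Prod_UNIV)
  moreover have "F \<subseteq> P"
    unfolding F_def using at(1) by auto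
  ultimately obtain n g where g: "isometry g" "F \<subseteq> (\<lambda>T. g ` T) ` supertile n"
    using P(2) by meson
  have F_eq: "\<exists>w. length w = n \<and> S = (g \<circ> place w) ` unit_triangle" if S: "S \<in> F" for S
  proof -
    obtain T where "T \<in> supertile n" "S = g ` T"
      using g(2) S by blast
    then show ?thesis
      using supertile_subset[of T n] by (metis image_comp)
  qed
  obtain v where v: "length v = n" "?T = (g \<circ> place v) ` unit_triangle"
    using F_eq[of ?T] unfolding F_def by blast
  obtain v' where v': "length v' = n" "tile_at z = (g \<circ> place v') ` unit_triangle"
    using F_eq[of "tile_at z"] unfolding F_def by blast
  have "v \<noteq> v'"
    using z at(2)[of z] v(2) v'(2) by metis
  then obtain i w where w: "v = i # w"
    using v(1) v'(1) by (metis length_0_conv neq_Nil_conv)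
  have eq: "\<phi> = g \<circ> place (i # w)"
    using \<phi> v(2) isometry_placement[OF g(1) placement_place] unfolding w
    by (intro placement_unique) (simp_all del: place.simps)
  have "(g \<circ> place (j # w)) ` unit_triangle \<in> P" for j
  proof -
    let ?z = "s (i, j)"
    have "kid_map i (inv (kid_map i) (kid_map j inner_pt)) = kid_map j inner_pt"
      by (rule surj_f_inv_f[OF surj_kid_map])
    then have z: "?z = g (place (j # w) inner_pt)"
      by (simp add: s_def eq)
    obtain u where u: "length u = n" "tile_at ?z = (g \<circ> place u) ` unit_triangle"
      using F_eq[of "tile_at ?z"] unfolding F_def comp_def by blast
    have "g (place (j # w) inner_pt) \<in> g ` place u ` unit_triangle"
      using at(2)[of ?z] by (simp only: u(2) z[symmetric] image_comp)
    then have "place (j # w) inner_pt \<in> place u ` unit_triangle"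
      using isometry_inj[OF g(1)] by (simp only: inj_image_mem_iff)
    then have "u = j # w"
      using place_inner_pt_notin[of "j # w" u] u(1) v(1) w by auto
    then show ?thesis
      using u(2) at(1)[of ?z] by simp
  qed
  then show ?thesis
    using that g(1) by blast
qed

lemma pinwheel_colours_ge_3:
  assumes "pinwheel_tiling P" "face_colourable P k"
  shows "3 \<le> k"
proof -
  obtain g w where g: "isometry g" and P: "\<And>j. (g \<circ> place (j # w)) ` unit_triangle \<in> P"
    using pinwheel_siblings[OF assms(1)] by metis
  obtain c :: "(real^2) set \<Rightarrow> nat" where c: "proper_face_colouring P c" "c ` P \<subseteq> {..<k}"
    using assms(2) unfolding face_colourable_def by blast
  define S where "S j = (g \<circ> place (j # w)) ` unit_triangle" for j
  have S: "S j \<in> P" for j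
    unfolding S_def by (rule P)
  have differ: "c (S i) \<noteq> c (S j)" if "i \<noteq> j" "glued x y d (kid_map i) (kid_map j)" for i j x y d
  proof -
    have "glued x y d (g \<circ> place (i # w)) (g \<circ> place (j # w))"
      unfolding place.simps by (intro glued_comp that(2))
    then have "share_segment (S i) (S j)"
      unfolding S_def by (intro glued_share_segment isometry_placement g placement_place)
    moreover have "S i \<noteq> S j"
    proof
      assume "S i = S j"
      moreover have "inner_pt \<in> unit_triangle"
        by (simp add: inner_pt_def unit_triangle_def)
      ultimately have "g (place (i # w) inner_pt) \<in> g ` place (j # w) ` unit_triangle"
        unfolding S_def by (metis image_comp comp_apply imageI)
      then have "place (i # w) inner_pt \<in> place (j # w) ` unit_triangle"
        using isometry_inj[OF g] by (simp only: inj_image_mem_iff)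
      then show False
        using place_inner_pt_notin[of "i # w" "j # w"] that(1) by simp
    qed
    ultimately show ?thesis
      using c(1) S unfolding proper_face_colouring_def by blast
  qed
  \<comment> \<open>These three children touch pairwise around the midpoint of the long leg of the
    first.\<close>
  have "c (S K2) \<noteq> c (S K1)" "c (S K3) \<noteq> c (S K1)" "c (S K2) \<noteq> c (S K3)"
    using differ[OF _ glued_siblings(1)] differ[OF _ glued_siblings(2)] differ[OF _ glued_siblings(3)]
    by simp_all
  moreover have "c (S j) < k" for j
    using c(2) S by blast
  then have "c (S K1) < k" "c (S K2) < k" "c (S K3) < k"
    by simp_all
  ultimately show ?thesis
    by linarith
qed

theorem theorem6p9:
  fixes P :: "(real^2) set set"
  assumes "pinwheel_tiling P"
  shows "face_colourable P 3 \<and> (\<forall>k. face_colourable P k \<longrightarrow> 3 \<le> k)"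
  using pinwheel_3_colourable[OF assms] pinwheel_colours_ge_3[OF assms] by blast

end
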